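(* For any total functions $f,g,h\colon\omega\to\omega$, if $f\cap g\leq_{\rm subT} h$, then $f\leq_{\rm subT} h$ or $g\leq_{\rm subT} h$.
   Context: For a partial computable function $\Phi$ from finite sequences of natural numbers to $\{0,1\}\times\omega$ and a partial function $g\colon\subseteq\omega\to\omega$, the $g$-relative sequential computation $\Phi[g]$ is defined as follows. On input $n$, with oracle answers $a_0,\dots,a_{s-1}$ obtained so far: if $\Phi(n,a_0,\dots,a_{s-1})$ is undefined, $\Phi[g](n)$ is undefined; if it equals $\langle 1,q\rangle$ the computation halts with output $q$; if it equals $\langle 0,q\rangle$, $q$ is a query, and if $q\in{\rm dom}(g)$ the computation continues with $a_s=g(q)$, while if $q\notin{\rm dom}(g)$ the computation never halts. $\Phi_e$ is the $e$-th such partial computable function. $f\leq_{\rm subT} g$ means $f\subseteq\Phi_e[g]$ for some $e$. The meet $f\cap g$ is the partial function with $(f\cap g)(\langle d,e,n\rangle)=\Phi_d[f](n)$ if $\Phi_d[f](n)$ and $\Phi_e[g](n)$ are both defined and equal, and undefined otherwise; it is the greatest lower bound of $f$ and $g$ under $\leq_{\rm subT}$. *)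

theory Defs
  imports Main "HOL-Library.Nat_Bijection" "HOL-Library.Monad_Syntax"
begin

text \<open>
  Programs for the unary partial recursive functions over the Cantor pairing: the class containing
  zero, successor and the two projections and closed under pairing, composition, primitive recursion
  and unbounded minimisation. Functions of several arguments are treated by pairing.
\<close>

datatype prog =
    Zero
  | Succ
  | Fst
  | Snd
  | Pair prog prog
  | Comp prog prog
  | Prec prog prog
  | Mu prog

primrec eval_prog :: "prog \<Rightarrow> nat \<Rightarrow> nat option" where
  "eval_prog Zero = (\<lambda>x. Some 0)"
| "eval_prog Succ = (\<lambda>x. Some (Suc x))"
| "eval_prog Fst = (\<lambda>x. Some (fst (prod_decode x)))"
| "eval_prog Snd = (\<lambda>x. Some (snd (prod_decode x)))"
| "eval_prog (Pair p q) = (\<lambda>x. do {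
     u \<leftarrow> eval_prog p x;
     v \<leftarrow> eval_prog q x;
     Some (prod_encode (u, v)) })"
| "eval_prog (Comp p q) = (\<lambda>x. do { u \<leftarrow> eval_prog q x; eval_prog p u })"
| "eval_prog (Prec p q) = (\<lambda>x. case prod_decode x of (a, k) \<Rightarrow>
     rec_nat (eval_prog p a)
       (\<lambda>i r. do { v \<leftarrow> r; eval_prog q (prod_encode (a, prod_encode (i, v))) }) k)"
| "eval_prog (Mu p) = (\<lambda>x.
     let is_min = (\<lambda>k. eval_prog p (prod_encode (x, k)) = Some 0 \<and>
                       (\<forall>j<k. \<exists>v. eval_prog p (prod_encode (x, j)) = Some (Suc v)))
     in if \<exists>k. is_min k then Some (THE k. is_min k) else None)"

function prog_of :: "nat \<Rightarrow> prog" where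
  "prog_of e =
     (if e = 0 then Zero
      else if e = 1 then Succ
      else if e = 2 then Fst
      else if e = 3 then Snd
      else let m = (e - 4) div 4; i = fst (prod_decode m); j = snd (prod_decode m) in
        if e mod 4 = 0 then Pair (prog_of i) (prog_of j)
        else if e mod 4 = 1 then Comp (prog_of i) (prog_of j)
        else if e mod 4 = 2 then Prec (prog_of i) (prog_of j)
        else Mu (prog_of m))"
  by pat_completeness auto
termination
proof (relation "measure id", goal_cases)
  have fst_le: "fst (prod_decode m) \<le> m" and snd_le: "snd (prod_decode m) \<le> m" for m
    using le_prod_encode_1[of "fst (prod_decode m)" "snd (prod_decode m)"]
      le_prod_encode_2[of "snd (prod_decode m)" "fst (prod_decode m)"] by simp_all
  have small: "(e - 4) div 4 < e" if "e \<noteq> 0" for e :: nat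
    using that by linarith
  {
    case 1 show ?case by simp
  next
    case 2 then show ?case using le_less_trans[OF fst_le small] by simp
  next
    case 3 then show ?case using le_less_trans[OF snd_le small] by simp
  next
    case 4 then show ?case using le_less_trans[OF fst_le small] by simp
  next
    case 5 then show ?case using le_less_trans[OF snd_le small] by simp
  next
    case 6 then show ?case using le_less_trans[OF fst_le small] by simp
  next
    case 7 then show ?case using le_less_trans[OF snd_le small] by simp
  next
    case 8 then show ?case using small by simp
  }
qed

declare prog_of.simps [simp del]

lemma surj_prog_of: "\<exists>e. prog_of e = p"
proof (induction p)
  case Zero
  have "prog_of 0 = Zero" by (subst prog_of.simps) simp
  then show ?case ..
next
  case Succ
  have "prog_of 1 = Succ" by (subst prog_of.simps) simp
  then show ?case ..
next
  case Fst
  have "prog_of 2 = Fst" by (subst prog_of.simps) simp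
  then show ?case ..
next
  case Snd
  have "prog_of 3 = Snd" by (subst prog_of.simps) simp
  then show ?case ..
next
  case (Pair p q)
  then obtain i j where "prog_of i = p" "prog_of j = q" by blast
  then have "prog_of (4 * prod_encode (i, j) + 4) = Pair p q"
    by (subst prog_of.simps) (simp add: Let_def)
  then show ?case ..
next
  case (Comp p q)
  then obtain i j where "prog_of i = p" "prog_of j = q" by blast
  moreover have "(4 * m + 5) mod 4 = 1" "(4 * m + 1) div 4 = m" for m :: nat by presburger+
  ultimately have "prog_of (4 * prod_encode (i, j) + 5) = Comp p q"
    by (subst prog_of.simps) (simp add: Let_def)
  then show ?case ..
next
  case (Prec p q)
  then obtain i j where "prog_of i = p" "prog_of j = q" by blast
  moreover have "(4 * m + 6) mod 4 = 2" "(4 * m + 2) div 4 = m" for m :: nat by presburger+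
  ultimately have "prog_of (4 * prod_encode (i, j) + 6) = Prec p q"
    by (subst prog_of.simps) (simp add: Let_def)
  then show ?case ..
next
  case (Mu p)
  then obtain m where "prog_of m = p" by blast
  moreover have "(4 * m + 7) mod 4 = 3" "(4 * m + 3) div 4 = m" for m :: nat by presburger+
  ultimately have "prog_of (4 * m + 7) = Mu p"
    by (subst prog_of.simps) (simp add: Let_def)
  then show ?case ..
qed

text \<open>
  The \<open>e\<close>-th partial computable function from finite sequences of natural numbers to
  \<open>{0,1} \<times> \<omega>\<close>. The flag 1 (halt) is \<open>True\<close>, the flag 0 (query) is \<open>False\<close>; the pair
  \<open>(b, q)\<close> is coded by the number \<open>2 * q + b\<close>.
\<close>

definition Phi :: "nat \<Rightarrow> nat list \<Rightarrow> (bool \<times> nat) option" where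
  "Phi e xs = map_option (\<lambda>v. (odd v, v div 2)) (eval_prog (prog_of e) (list_encode xs))"

text \<open>
  Here \<open>xs\<close> is the input followed by the oracle answers received so far. The least fixed point
  makes an infinite sequence of queries undefined.
\<close>

partial_function (option) seq_run ::
  "(nat list \<Rightarrow> (bool \<times> nat) option) \<Rightarrow> (nat \<Rightarrow> nat option) \<Rightarrow> nat list \<Rightarrow> nat option" where
  "seq_run \<Phi> g xs = do {
     (halt, q) \<leftarrow> \<Phi> xs;
     if halt then Some q else do { a \<leftarrow> g q; seq_run \<Phi> g (xs @ [a]) } }"

definition seq_comp ::
  "(nat list \<Rightarrow> (bool \<times> nat) option) \<Rightarrow> (nat \<Rightarrow> nat option) \<Rightarrow> nat \<Rightarrow> nat option" where
  "seq_comp \<Phi> g n = seq_run \<Phi> g [n]"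

definition subT_le :: "(nat \<Rightarrow> nat option) \<Rightarrow> (nat \<Rightarrow> nat option) \<Rightarrow> bool"
    (infix "\<le>\<^sub>s\<^sub>u\<^sub>b\<^sub>T" 50) where
  "f \<le>\<^sub>s\<^sub>u\<^sub>b\<^sub>T g \<longleftrightarrow> (\<exists>e. f \<subseteq>\<^sub>m seq_comp (Phi e) g)"

text \<open>The argument is the triple \<open>\<langle>d, e, n\<rangle>\<close>, coded as \<open>\<langle>d, \<langle>e, n\<rangle>\<rangle>\<close>.\<close>

definition subT_meet :: "(nat \<Rightarrow> nat option) \<Rightarrow> (nat \<Rightarrow> nat option) \<Rightarrow> nat \<Rightarrow> nat option"
    (infixl "\<sqinter>\<^sub>s\<^sub>u\<^sub>b\<^sub>T" 70) where
  "(f \<sqinter>\<^sub>s\<^sub>u\<^sub>b\<^sub>T g) x =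
     (let (d, y) = prod_decode x; (e, n) = prod_decode y in
      if seq_comp (Phi d) f n \<noteq> None \<and> seq_comp (Phi d) f n = seq_comp (Phi e) g n
      then seq_comp (Phi d) f n else None)"

end

theory Submission
  imports Defs
begin

text \<open>
  Suppose that \<open>\<Phi>[h]\<close> extends the meet of \<open>f\<close> and \<open>g\<close>. Fix indices \<open>d\<close> and \<open>e\<close> such that on
  input \<open>\<langle>\<langle>a, b\<rangle>, \<langle>u, v\<rangle>\<rangle>\<close> the first asks whether \<open>f a = u\<close> and the second whether \<open>g b = v\<close>,
  answering 0 for yes and 1 for no. Let \<open>S a b\<close> be the set of pairs \<open>(u, v)\<close> for which \<open>\<Phi>[h]\<close>
  returns 0 on the corresponding argument of the meet. It is enumerable in \<open>h\<close>, contains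
  \<open>(f a, g b)\<close>, and is contained in the cross \<open>u = f a \<or> v = g b\<close>, because off the cross both
  answers are 1.

  Hence two distinct points of \<open>S a b\<close> with the same second coordinate \<open>v\<close> certify \<open>v = g b\<close>. If
  for every \<open>b\<close> some \<open>a\<close> provides such a certificate, then the graph of \<open>g\<close> is enumerable in \<open>h\<close>.
  Otherwise some fixed \<open>b\<close> has none, so \<open>f a\<close> is the only first coordinate of a point of \<open>S a b\<close>,
  and the graph of \<open>f\<close> is enumerable in \<open>h\<close>. A function whose graph is enumerable in \<open>h\<close> is
  computed from \<open>h\<close> by unbounded search.

  Predicates enumerable in \<open>h\<close> are closed under conjunction, existential and bounded universal
  quantification and reflexive transitive closure. Since primitive recursion and oracle
  computations are iterations of a step relation, the graph of \<open>\<Phi>[h]\<close> is enumerable in \<open>h\<close>.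
\<close>

section \<open>Total computable functions\<close>

abbreviation pfst :: "nat \<Rightarrow> nat" where "pfst z \<equiv> fst (prod_decode z)"
abbreviation psnd :: "nat \<Rightarrow> nat" where "psnd z \<equiv> snd (prod_decode z)"

definition computable :: "(nat \<Rightarrow> nat) \<Rightarrow> bool" where
  "computable F \<longleftrightarrow> (\<exists>p. \<forall>x. eval_prog p x = Some (F x))"

named_theorems computable_intros

lemma computableI: "(\<And>x. eval_prog p x = Some (F x)) \<Longrightarrow> computable F"
  unfolding computable_def by blast

lemma computable_comp:
  assumes "computable F" "computable G"
  shows "computable (\<lambda>x. F (G x))"
proof -
  obtain p q where "\<And>x. eval_prog p x = Some (F x)" "\<And>x. eval_prog q x = Some (G x)"
    using assms unfolding computable_def by blast
  then show ?thesis by (intro computableI[of "Comp p q"]) simp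
qed

lemma computable_prod_encode [computable_intros]:
  assumes "computable F" "computable G"
  shows "computable (\<lambda>x. prod_encode (F x, G x))"
proof -
  obtain p q where "\<And>x. eval_prog p x = Some (F x)" "\<And>x. eval_prog q x = Some (G x)"
    using assms unfolding computable_def by blast
  then show ?thesis by (intro computableI[of "Pair p q"]) simp
qed

lemma computable_Suc [computable_intros]: "computable F \<Longrightarrow> computable (\<lambda>x. Suc (F x))"
  by (rule computable_comp[of Suc]) (auto intro: computableI[of Succ])

lemma computable_pfst [computable_intros]: "computable F \<Longrightarrow> computable (\<lambda>x. pfst (F x))"
  by (rule computable_comp[of pfst]) (auto intro: computableI[of Fst])

lemma computable_psnd [computable_intros]: "computable F \<Longrightarrow> computable (\<lambda>x. psnd (F x))"
  by (rule computable_comp[of psnd]) (auto intro: computableI[of Snd])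

lemma computable_id [computable_intros]: "computable (\<lambda>x. x)"
  by (rule computableI[of "Pair Fst Snd"]) simp

lemma computable_const [computable_intros]: "computable (\<lambda>x. c)"
proof (induction c)
  case 0
  show ?case by (rule computableI[of Zero]) simp
qed (rule computable_Suc)

lemma computable_comp2:
  assumes "computable (\<lambda>z. F (pfst z) (psnd z))" "computable G" "computable H"
  shows "computable (\<lambda>x. F (G x) (H x))"
  using computable_comp[OF assms(1) computable_prod_encode[OF assms(2,3)]] by simp

lemma computable_comp3:
  assumes "computable (\<lambda>z. F (pfst z) (pfst (psnd z)) (psnd (psnd z)))"
    and "computable G" "computable H" "computable K"
  shows "computable (\<lambda>x. F (G x) (H x) (K x))"
  using computable_comp2[OF assms(1,2) computable_prod_encode[OF assms(3,4)]] by simp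

lemma computable_rec_nat [computable_intros]:
  assumes "computable A" "computable (\<lambda>z. B (pfst z) (pfst (psnd z)) (psnd (psnd z)))" "computable K"
  shows "computable (\<lambda>x. rec_nat (A x) (B x) (K x))"
proof -
  obtain p q where p: "\<And>x. eval_prog p x = Some (A x)"
    and q: "\<And>z. eval_prog q z = Some (B (pfst z) (pfst (psnd z)) (psnd (psnd z)))"
    using assms(1,2) unfolding computable_def by blast
  have "rec_nat (eval_prog p a)
       (\<lambda>i r. do { v \<leftarrow> r; eval_prog q (prod_encode (a, prod_encode (i, v))) }) k
     = Some (rec_nat (A a) (B a) k)" for a k
    by (induction k) (simp_all add: p q)
  then have "computable (\<lambda>z. rec_nat (A (pfst z)) (B (pfst z)) (psnd z))"
    by (intro computableI[of "Prec p q"]) (simp add: case_prod_beta)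
  from computable_comp2[OF this computable_id assms(3)] show ?thesis .
qed

lemma computable_funpow [computable_intros]:
  assumes "computable (\<lambda>z. F (pfst z) (psnd z))" "computable K" "computable A"
  shows "computable (\<lambda>x. (F x ^^ K x) (A x))"
proof -
  have rec: "(F x ^^ k) a = rec_nat a (\<lambda>i r. F x r) k" for x k a
    by (induction k) simp_all
  show ?thesis unfolding rec by (intro computable_intros assms computable_comp2[OF assms(1)])
qed

lemma computable_add [computable_intros]:
  assumes "computable F" "computable G"
  shows "computable (\<lambda>x. F x + G x)"
proof -
  have "F x + G x = (Suc ^^ F x) (G x)" for x by simp
  then show ?thesis by (simp only:) (intro computable_intros assms)
qed

lemma computable_pred [computable_intros]:
  assumes "computable F"
  shows "computable (\<lambda>x. F x - 1)"
proof -
  have rec: "k - 1 = rec_nat 0 (\<lambda>i r. i) k" for k :: nat by (cases k) simp_all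
  show ?thesis unfolding rec by (intro computable_intros assms)
qed

lemma computable_diff [computable_intros]:
  assumes "computable F" "computable G"
  shows "computable (\<lambda>x. F x - G x)"
proof -
  have iter: "m - k = ((\<lambda>r. r - 1) ^^ k) m" for m k :: nat
    by (induction k) (simp_all flip: diff_Suc_eq_diff_pred)
  show ?thesis unfolding iter[of "F _"] by (intro computable_intros assms)
qed

lemma computable_if_eq [computable_intros]:
  assumes "computable F" "computable G" "computable A" "computable B"
  shows "computable (\<lambda>x. if F x = G x then A x else B x)"
proof -
  have rec: "(if F x = G x then A x else B x) =
      rec_nat (A x) (\<lambda>i r. B x) ((F x - G x) + (G x - F x))" for x
    by (cases "(F x - G x) + (G x - F x)") auto
  show ?thesis unfolding rec by (intro computable_intros assms[THEN computable_comp] assms)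
qed

text \<open>The last \<open>i < k\<close> with \<open>W i = 0\<close>, shifted by one so that 0 reports failure.\<close>

definition bounded_search :: "(nat \<Rightarrow> nat) \<Rightarrow> nat \<Rightarrow> nat" where
  "bounded_search W k = rec_nat 0 (\<lambda>i r. if W i = 0 then Suc i else r) k"

lemma bounded_search_eq_0_iff: "bounded_search W k = 0 \<longleftrightarrow> (\<forall>i<k. W i \<noteq> 0)"
  by (induction k) (auto simp: bounded_search_def less_Suc_eq)

lemma bounded_search_eq_SucD: "bounded_search W k = Suc i \<Longrightarrow> W i = 0"
  by (induction k) (auto simp: bounded_search_def split: if_splits)

lemma computable_bounded_search [computable_intros]:
  assumes "computable (\<lambda>z. W (pfst z) (psnd z))" "computable K"
  shows "computable (\<lambda>x. bounded_search (W x) (K x))"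
  unfolding bounded_search_def
  by (intro computable_intros assms(2) computable_comp2[OF assms(1)])

section \<open>Computable operations on lists\<close>

lemma list_encode_eq_0_iff [simp]: "list_encode xs = 0 \<longleftrightarrow> xs = []"
  by (cases xs) simp_all

lemma computable_list_decode [computable_intros]:
  "computable F \<Longrightarrow> computable (\<lambda>x. list_encode (list_decode (F x)))"
  by simp

lemma computable_Cons [computable_intros]:
  assumes "computable F" "computable (\<lambda>x. list_encode (L x))"
  shows "computable (\<lambda>x. list_encode (F x # L x))"
  unfolding list_encode.simps by (intro computable_intros assms)

text \<open>The unspecified value of \<open>hd []\<close> is harmless, being a constant.\<close>

lemma computable_hd [computable_intros]:
  assumes "computable (\<lambda>x. list_encode (L x))"
  shows "computable (\<lambda>x. hd (L x))"
proof -
  have "hd xs = (if list_encode xs = 0 then hd [] else pfst (list_encode xs - 1))" for xs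
    by (cases xs) simp_all
  from this[of "L _"] show ?thesis by (simp only:) (intro computable_intros assms)
qed

lemma computable_tl [computable_intros]:
  assumes "computable (\<lambda>x. list_encode (L x))"
  shows "computable (\<lambda>x. list_encode (tl (L x)))"
proof -
  have "list_encode (tl xs) = (if list_encode xs = 0 then 0 else psnd (list_encode xs - 1))" for xs
    by (cases xs) simp_all
  from this[of "L _"] show ?thesis by (simp only:) (intro computable_intros assms)
qed

lemma computable_drop [computable_intros]:
  assumes "computable K" "computable (\<lambda>x. list_encode (L x))"
  shows "computable (\<lambda>x. list_encode (drop (K x) (L x)))"
proof -
  have iter: "list_encode (drop k xs) = ((\<lambda>c. list_encode (tl (list_decode c))) ^^ k) (list_encode xs)"
    for k xs
  proof (induction k)
    case (Suc k)
    then show ?case by (simp add: drop_Suc tl_drop flip: Suc.IH)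
  qed simp
  show ?thesis unfolding iter by (intro computable_intros assms)
qed

lemma length_le_list_encode: "length xs \<le> list_encode xs"
proof (induction xs)
  case (Cons x xs)
  then show ?case using le_prod_encode_2[of "list_encode xs" x] by simp
qed simp

lemma computable_fold [computable_intros]:
  assumes "computable (\<lambda>z. F (pfst z) (pfst (psnd z)) (psnd (psnd z)))"
    and "computable (\<lambda>x. list_encode (L x))" "computable A"
  shows "computable (\<lambda>x. fold (F x) (L x) (A x))"
proof -
  let ?step = "\<lambda>f xs i r. if list_encode (drop i xs) = 0 then r else f (hd (drop i xs)) r"
  have take: "rec_nat a (?step f xs) k = fold f (take k xs) a" for f xs and a :: nat and k
  proof (induction k)
    case (Suc k)
    then show ?case
      by (cases "k < length xs") (simp_all add: take_Suc_conv_app_nth hd_drop_conv_nth)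
  qed simp
  have rec: "fold f xs a = rec_nat a (?step f xs) (list_encode xs)" for f xs and a :: nat
    unfolding take by (simp add: length_le_list_encode)
  show ?thesis unfolding rec
    by (intro computable_intros assms(2,3) computable_comp3[OF assms(1)] computable_comp[OF assms(2)])
qed

lemma computable_length [computable_intros]:
  assumes "computable (\<lambda>x. list_encode (L x))"
  shows "computable (\<lambda>x. length (L x))"
proof -
  have "fold (\<lambda>_. Suc) xs n = length xs + n" for xs :: "nat list" and n
    by (induction xs arbitrary: n) simp_all
  from this[of _ 0] have fold: "length xs = fold (\<lambda>_. Suc) xs 0" for xs :: "nat list"
    by simp
  show ?thesis unfolding fold by (intro computable_intros assms)
qed

lemma computable_append [computable_intros]:
  assumes "computable (\<lambda>x. list_encode (L x))" "computable (\<lambda>x. list_encode (M x))"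
  shows "computable (\<lambda>x. list_encode (L x @ M x))"
proof -
  have fold: "list_encode (rev xs @ ys) = fold (\<lambda>x c. Suc (prod_encode (x, c))) xs (list_encode ys)"
    for xs ys
    by (induction xs arbitrary: ys) (simp_all flip: list_encode.simps)
  have "computable (\<lambda>x. list_encode (rev (L x) @ []))"
    unfolding fold by (intro computable_intros assms)
  then have "computable (\<lambda>x. list_encode (rev (L x)))" by (simp only: append_Nil2)
  then have "computable (\<lambda>x. list_encode (rev (rev (L x)) @ M x))"
    unfolding fold by (intro computable_intros assms)
  then show ?thesis by simp
qed

section \<open>Predicates computably enumerable in a total oracle\<close>

text \<open>
  A test of \<open>P\<close> sees finitely many values of the oracle and answers 0 for acceptance. Acceptance
  must be correct, and on points satisfying \<open>P\<close> it must eventually persist, so that tests can be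
  combined stage by stage.
\<close>

definition ce_test :: "(nat \<Rightarrow> nat) \<Rightarrow> (nat \<Rightarrow> bool) \<Rightarrow> (nat \<Rightarrow> nat list \<Rightarrow> nat) \<Rightarrow> bool" where
  "ce_test h P W \<longleftrightarrow> computable (\<lambda>z. W (pfst z) (list_decode (psnd z))) \<and>
     (\<forall>x s. W x (map h [0..<s]) = 0 \<longrightarrow> P x) \<and>
     (\<forall>x. P x \<longrightarrow> (\<forall>\<^sub>F s in at_top. W x (map h [0..<s]) = 0))"

definition ce_in :: "(nat \<Rightarrow> nat) \<Rightarrow> (nat \<Rightarrow> bool) \<Rightarrow> bool" where
  "ce_in h P \<longleftrightarrow> (\<exists>W. ce_test h P W)"

named_theorems ce_in_intros

lemma ce_inI:
  assumes "computable (\<lambda>z. W (pfst z) (list_decode (psnd z)))"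
    and "\<And>x s. W x (map h [0..<s]) = 0 \<Longrightarrow> P x"
    and "\<And>x. P x \<Longrightarrow> \<forall>\<^sub>F s in at_top. W x (map h [0..<s]) = 0"
  shows "ce_in h P"
  using assms unfolding ce_in_def ce_test_def by blast

lemma ce_test_computable:
  assumes "ce_test h P W" "computable F" "computable (\<lambda>x. list_encode (L x))"
  shows "computable (\<lambda>x. W (F x) (L x))"
proof -
  have "computable (\<lambda>z. W (pfst z) (list_decode (psnd z)))"
    using assms(1) unfolding ce_test_def by blast
  from computable_comp2[OF this assms(2,3)] show ?thesis by simp
qed

lemma ce_test_sound: "ce_test h P W \<Longrightarrow> W x (map h [0..<s]) = 0 \<Longrightarrow> P x"
  unfolding ce_test_def by blast

lemma ce_test_eventually:
  "ce_test h P W \<Longrightarrow> P x \<Longrightarrow> \<forall>\<^sub>F s in at_top. W x (map h [0..<s]) = 0"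
  unfolding ce_test_def by blast

lemma ce_in_comp:
  assumes "ce_in h P" "computable F"
  shows "ce_in h (\<lambda>x. P (F x))"
proof -
  obtain W where W: "ce_test h P W" using assms(1) unfolding ce_in_def by blast
  show ?thesis
  proof (rule ce_inI[of "\<lambda>x. W (F x)"])
    show "computable (\<lambda>z. W (F (pfst z)) (list_decode (psnd z)))"
      by (intro ce_test_computable[OF W] computable_comp[OF assms(2)] computable_intros)
  qed (fact ce_test_sound[OF W] ce_test_eventually[OF W])+
qed

lemma ce_in_eq [ce_in_intros]:
  assumes "computable F" "computable G"
  shows "ce_in h (\<lambda>x. F x = G x)"
proof (rule ce_inI)
  show "computable (\<lambda>z. if F (pfst z) = G (pfst z) then 0 else 1)"
    by (intro computable_intros assms[THEN computable_comp])
qed (auto split: if_splits)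

lemma ce_in_neq [ce_in_intros]:
  assumes "computable F" "computable G"
  shows "ce_in h (\<lambda>x. F x \<noteq> G x)"
proof (rule ce_inI)
  show "computable (\<lambda>z. if F (pfst z) = G (pfst z) then 1 else 0)"
    by (intro computable_intros assms[THEN computable_comp])
qed (auto split: if_splits)

lemma ce_in_oracle [ce_in_intros]:
  assumes "computable F" "computable G"
  shows "ce_in h (\<lambda>x. h (F x) = G x)"
proof (rule ce_inI)
  let ?W = "\<lambda>x as. if length (drop (F x) as) = 0 then 1 else
    if hd (drop (F x) as) = G x then 0 else 1 :: nat"
  show "computable (\<lambda>z. ?W (pfst z) (list_decode (psnd z)))"
    by (intro computable_intros assms[THEN computable_comp])
  have W: "?W x (map h [0..<s]) = 0 \<longleftrightarrow> F x < s \<and> h (F x) = G x" for x s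
    by (simp add: hd_drop_conv_nth)
  show "h (F x) = G x" if "?W x (map h [0..<s]) = 0" for x s
    using that unfolding W by blast
  show "\<forall>\<^sub>F s in at_top. ?W x (map h [0..<s]) = 0" if "h (F x) = G x" for x
    unfolding W using that by (simp add: eventually_gt_at_top)
qed

lemma ce_in_conj [ce_in_intros]:
  assumes "ce_in h P" "ce_in h Q"
  shows "ce_in h (\<lambda>x. P x \<and> Q x)"
proof -
  obtain V W where V: "ce_test h P V" and W: "ce_test h Q W"
    using assms unfolding ce_in_def by blast
  show ?thesis
  proof (rule ce_inI)
    let ?U = "\<lambda>x as. V x as + W x as"
    show "computable (\<lambda>z. ?U (pfst z) (list_decode (psnd z)))"
      by (intro computable_intros ce_test_computable[OF V] ce_test_computable[OF W])
    show "P x \<and> Q x" if "?U x (map h [0..<s]) = 0" for x s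
      using that ce_test_sound[OF V, of x s] ce_test_sound[OF W, of x s] by simp
    show "\<forall>\<^sub>F s in at_top. ?U x (map h [0..<s]) = 0" if "P x \<and> Q x" for x
      using ce_test_eventually[OF V conjunct1[OF that]] ce_test_eventually[OF W conjunct2[OF that]]
      by eventually_elim simp
  qed
qed

definition witness_search :: "(nat \<Rightarrow> nat list \<Rightarrow> nat) \<Rightarrow> nat \<Rightarrow> nat list \<Rightarrow> nat" where
  "witness_search W x as = bounded_search (\<lambda>y. W (prod_encode (x, y)) as) (length as)"

lemma computable_witness_search:
  assumes "ce_test h P W" "computable F" "computable (\<lambda>x. list_encode (L x))"
  shows "computable (\<lambda>x. witness_search W (F x) (L x))"
  unfolding witness_search_def
  by (intro computable_intros ce_test_computable[OF assms(1)] assms(2,3)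
      assms(2,3)[THEN computable_comp])

lemma witness_search_sound:
  assumes "ce_test h P W" "witness_search W x (map h [0..<s]) = Suc y"
  shows "P (prod_encode (x, y))"
  using assms ce_test_sound bounded_search_eq_SucD unfolding witness_search_def by blast

lemma witness_search_eventually:
  assumes "ce_test h P W" "P (prod_encode (x, y))"
  shows "\<forall>\<^sub>F s in at_top. witness_search W x (map h [0..<s]) \<noteq> 0"
  using ce_test_eventually[OF assms] eventually_gt_at_top[of y]
  by eventually_elim (auto simp: witness_search_def bounded_search_eq_0_iff)

lemma ce_in_ex [ce_in_intros]:
  assumes "ce_in h (\<lambda>z. P (pfst z) (psnd z))"
  shows "ce_in h (\<lambda>x. \<exists>y. P x y)"
proof -
  obtain W where W: "ce_test h (\<lambda>z. P (pfst z) (psnd z)) W"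
    using assms unfolding ce_in_def by blast
  show ?thesis
  proof (rule ce_inI)
    let ?V = "\<lambda>x as. if witness_search W x as = 0 then 1 else 0 :: nat"
    show "computable (\<lambda>z. ?V (pfst z) (list_decode (psnd z)))"
      by (intro computable_intros computable_witness_search[OF W])
    show "\<exists>y. P x y" if "?V x (map h [0..<s]) = 0" for x s
      using that witness_search_sound[OF W, of x s]
      by (cases "witness_search W x (map h [0..<s])") auto
    show "\<forall>\<^sub>F s in at_top. ?V x (map h [0..<s]) = 0" if "\<exists>y. P x y" for x
      using that witness_search_eventually[OF W, of x] by auto
  qed
qed

lemma ce_in_all_less [ce_in_intros]:
  assumes "ce_in h (\<lambda>z. P (pfst z) (psnd z))" "computable K"
  shows "ce_in h (\<lambda>x. \<forall>i<K x. P x i)"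
proof -
  obtain W where W: "ce_test h (\<lambda>z. P (pfst z) (psnd z)) W"
    using assms(1) unfolding ce_in_def by blast
  show ?thesis
  proof (rule ce_inI)
    let ?V = "\<lambda>x as. bounded_search (\<lambda>i. if W (prod_encode (x, i)) as = 0 then 1 else 0) (K x)"
    show "computable (\<lambda>z. ?V (pfst z) (list_decode (psnd z)))"
      by (intro computable_intros ce_test_computable[OF W] computable_comp[OF assms(2)])
    have V: "?V x as = 0 \<longleftrightarrow> (\<forall>i<K x. W (prod_encode (x, i)) as = 0)" for x as
      by (auto simp: bounded_search_eq_0_iff)
    show "\<forall>i<K x. P x i" if "?V x (map h [0..<s]) = 0" for x s
      using that ce_test_sound[OF W, of "prod_encode (x, _)"] unfolding V by auto
    show "\<forall>\<^sub>F s in at_top. ?V x (map h [0..<s]) = 0" if P: "\<forall>i<K x. P x i" for x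
    proof -
      have "\<forall>\<^sub>F s in at_top. \<forall>i\<in>{..<K x}. W (prod_encode (x, i)) (map h [0..<s]) = 0"
      proof (intro eventually_ball_finite ballI)
        show "\<forall>\<^sub>F s in at_top. W (prod_encode (x, i)) (map h [0..<s]) = 0" if "i \<in> {..<K x}" for i
          using ce_test_eventually[OF W, of "prod_encode (x, i)"] P that by simp
      qed simp
      then show ?thesis unfolding V by eventually_elim simp
    qed
  qed
qed

lemma rtranclp_iff_list_decode:
  "R\<^sup>*\<^sup>* a b \<longleftrightarrow> (\<exists>k c. hd (drop 0 (list_decode c)) = a \<and> hd (drop k (list_decode c)) = b \<and>
     (\<forall>i<k. R (hd (drop i (list_decode c))) (hd (drop (Suc i) (list_decode c)))))"
    (is "_ \<longleftrightarrow> (\<exists>k c. ?chain k c)")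
proof
  assume "R\<^sup>*\<^sup>* a b"
  then obtain k s where s: "s 0 = a" "s k = b" "\<forall>i<k. R (s i) (s (Suc i))"
    by (auto simp: rtranclp_power relpowp_fun_conv)
  have "hd (drop i (list_decode (list_encode (map s [0..<Suc k])))) = s i" if "i \<le> k" for i
    using that by (simp add: hd_drop_conv_nth del: upt_Suc)
  with s have "?chain k (list_encode (map s [0..<Suc k]))"
    by (simp del: upt_Suc list_encode_inverse drop0)
  then show "\<exists>k c. ?chain k c" by blast
next
  assume "\<exists>k c. ?chain k c"
  then obtain k c where "?chain k c" by blast
  then have "(R ^^ k) a b"
    unfolding relpowp_fun_conv by (rule exI[of _ "\<lambda>i. hd (drop i (list_decode c))"])
  then show "R\<^sup>*\<^sup>* a b" unfolding rtranclp_power by blast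
qed

lemma ce_in_rtranclp [ce_in_intros]:
  assumes R: "ce_in h (\<lambda>z. R (pfst z) (pfst (psnd z)) (psnd (psnd z)))"
    and "computable A" "computable B"
  shows "ce_in h (\<lambda>x. (R x)\<^sup>*\<^sup>* (A x) (B x))"
proof -
  have R_comp: "ce_in h (\<lambda>x. R (X x) (F x) (G x))"
    if "computable X" "computable F" "computable G" for X F G
    using ce_in_comp[OF R, of "\<lambda>x. prod_encode (X x, prod_encode (F x, G x))"] that
    by (simp add: computable_intros)
  show ?thesis unfolding rtranclp_iff_list_decode
    by (intro ce_in_intros R_comp computable_intros assms(2,3)[THEN computable_comp])
qed

section \<open>Computations are enumerable in their oracle\<close>

lemma eval_prog_Pair_eq_Some_iff:
  "eval_prog (Pair p q) x = Some y \<longleftrightarrow>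
     (\<exists>u v. eval_prog p x = Some u \<and> eval_prog q x = Some v \<and> prod_encode (u, v) = y)"
  by (auto simp: bind_eq_Some_conv)

lemma eval_prog_Comp_eq_Some_iff:
  "eval_prog (Comp p q) x = Some y \<longleftrightarrow> (\<exists>u. eval_prog q x = Some u \<and> eval_prog p u = Some y)"
  by (auto simp: bind_eq_Some_conv)

definition prec_step :: "prog \<Rightarrow> nat \<Rightarrow> nat \<Rightarrow> nat \<Rightarrow> bool" where
  "prec_step q a z z' \<longleftrightarrow> pfst z' = Suc (pfst z) \<and> eval_prog q (prod_encode (a, z)) = Some (psnd z')"

lemma prec_step_rtranclp_0_iff:
  "(prec_step q a)\<^sup>*\<^sup>* (prod_encode (0, v)) (prod_encode (0, y)) \<longleftrightarrow> v = y"
  by (auto simp: prec_step_def elim: rtranclp.cases)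

lemma prec_step_rtranclp_Suc_iff:
  "(prec_step q a)\<^sup>*\<^sup>* (prod_encode (0, v)) (prod_encode (Suc k, y)) \<longleftrightarrow>
     (\<exists>u. (prec_step q a)\<^sup>*\<^sup>* (prod_encode (0, v)) (prod_encode (k, u)) \<and>
       eval_prog q (prod_encode (a, prod_encode (k, u))) = Some y)"
    (is "?reach_Suc \<longleftrightarrow> (\<exists>u. ?reach u \<and> ?value u)")
proof
  assume ?reach_Suc
  then obtain z where z: "(prec_step q a)\<^sup>*\<^sup>* (prod_encode (0, v)) z"
    "prec_step q a z (prod_encode (Suc k, y))"
    by (auto elim: rtranclp.cases)
  then have "z = prod_encode (k, psnd z)"
    by (metis prec_step_def Suc_inject fst_conv prod.collapse prod_decode_inverse prod_encode_inverse)
  with z show "\<exists>u. ?reach u \<and> ?value u"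
    by (metis prec_step_def prod_encode_inverse snd_conv)
next
  assume "\<exists>u. ?reach u \<and> ?value u"
  then show ?reach_Suc
    by (auto simp: prec_step_def intro: rtranclp.rtrancl_into_rtrancl)
qed

lemma eval_prog_Prec_eq_Some_iff:
  "eval_prog (Prec p q) x = Some y \<longleftrightarrow> (\<exists>v. eval_prog p (pfst x) = Some v \<and>
     (prec_step q (pfst x))\<^sup>*\<^sup>* (prod_encode (0, v)) (prod_encode (psnd x, y)))"
proof -
  have "rec_nat (eval_prog p a)
      (\<lambda>i r. do { v \<leftarrow> r; eval_prog q (prod_encode (a, prod_encode (i, v))) }) k = Some y \<longleftrightarrow>
    (\<exists>v. eval_prog p a = Some v \<and> (prec_step q a)\<^sup>*\<^sup>* (prod_encode (0, v)) (prod_encode (k, y)))"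
    for a k y
    by (induction k arbitrary: y)
      (auto simp: prec_step_rtranclp_0_iff prec_step_rtranclp_Suc_iff bind_eq_Some_conv)
  then show ?thesis by (simp add: case_prod_beta)
qed

lemma eval_prog_Mu_eq_Some_iff:
  "eval_prog (Mu p) x = Some y \<longleftrightarrow> eval_prog p (prod_encode (x, y)) = Some 0 \<and>
     (\<forall>j<y. \<exists>v. eval_prog p (prod_encode (x, j)) = Some (Suc v))"
proof -
  let ?is_min = "\<lambda>k. eval_prog p (prod_encode (x, k)) = Some 0 \<and>
     (\<forall>j<k. \<exists>v. eval_prog p (prod_encode (x, j)) = Some (Suc v))"
  have unique: "k = l" if "?is_min k" "?is_min l" for k l
    using that by (metis linorder_neqE_nat option.inject nat.distinct(1))
  have the_min: "(THE k. ?is_min k) = k" if "?is_min k" for k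
    using that unique by (intro the_equality)
  show ?thesis
  proof
    assume "eval_prog (Mu p) x = Some y"
    then show "?is_min y" using the_min by (auto simp: Let_def split: if_splits)
  next
    assume "?is_min y"
    then show "eval_prog (Mu p) x = Some y"
      unfolding eval_prog.simps Let_def using the_min by auto
  qed
qed

lemma ce_in_eval_prog [ce_in_intros]:
  assumes "computable F" "computable G"
  shows "ce_in h (\<lambda>x. eval_prog p (F x) = Some (G x))"
  using assms
proof (induction p arbitrary: F G)
  case (Pair p q)
  then show ?case unfolding eval_prog_Pair_eq_Some_iff
    by (intro ce_in_intros Pair.IH computable_intros Pair.prems[THEN computable_comp])
next
  case (Comp p q)
  then show ?case unfolding eval_prog_Comp_eq_Some_iff
    by (intro ce_in_intros Comp.IH computable_intros Comp.prems[THEN computable_comp])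
next
  case (Prec p q)
  then show ?case unfolding eval_prog_Prec_eq_Some_iff prec_step_def
    by (intro ce_in_intros Prec.IH computable_intros Prec.prems[THEN computable_comp])
next
  case (Mu p)
  then show ?case unfolding eval_prog_Mu_eq_Some_iff
    by (intro ce_in_intros Mu.IH computable_intros Mu.prems Mu.prems[THEN computable_comp])
qed (simp_all add: ce_in_intros computable_intros)

definition query_step ::
  "(nat list \<Rightarrow> (bool \<times> nat) option) \<Rightarrow> (nat \<Rightarrow> nat option) \<Rightarrow> nat \<Rightarrow> nat \<Rightarrow> bool" where
  "query_step \<Phi> g c c' \<longleftrightarrow> (\<exists>q a. \<Phi> (list_decode c) = Some (False, q) \<and> g q = Some a \<and>
     list_encode (list_decode c @ [a]) = c')"

lemma seq_run_eq_SomeD: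
  "seq_run \<Phi> g xs = Some y \<Longrightarrow>
     \<exists>c. (query_step \<Phi> g)\<^sup>*\<^sup>* (list_encode xs) c \<and> \<Phi> (list_decode c) = Some (True, y)"
proof (induct rule: seq_run.raw_induct[rotated, consumes 1, case_names step])
  case (step run \<Phi> g xs y)
  from step(2) obtain halt q where \<Phi>: "\<Phi> xs = Some (halt, q)"
    and "(if halt then Some q else do { a \<leftarrow> g q; run \<Phi> g (xs @ [a]) }) = Some y"
    by (auto simp: bind_eq_Some_conv)
  then consider (halt) "halt" "q = y"
    | (query) a where "\<not> halt" "g q = Some a" "run \<Phi> g (xs @ [a]) = Some y"
    by (auto simp: bind_eq_Some_conv split: if_splits)
  then show ?case
  proof cases
    case halt
    with \<Phi> show ?thesis by (intro exI[of _ "list_encode xs"]) simp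
  next
    case query
    then have "query_step \<Phi> g (list_encode xs) (list_encode (xs @ [a]))"
      using \<Phi> by (auto simp: query_step_def)
    with step(1)[OF query(3)] show ?thesis by (blast intro: converse_rtranclp_into_rtranclp)
  qed
qed

lemma seq_run_query_step_rtranclp:
  "(query_step \<Phi> g)\<^sup>*\<^sup>* b c \<Longrightarrow> seq_run \<Phi> g (list_decode b) = seq_run \<Phi> g (list_decode c)"
proof (induction rule: converse_rtranclp_induct)
  case (step b b')
  then show ?case by (subst seq_run.simps) (auto simp: query_step_def)
qed simp

lemma seq_run_eq_Some_iff:
  "seq_run \<Phi> g xs = Some y \<longleftrightarrow>
     (\<exists>c. (query_step \<Phi> g)\<^sup>*\<^sup>* (list_encode xs) c \<and> \<Phi> (list_decode c) = Some (True, y))"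
proof
  assume "\<exists>c. (query_step \<Phi> g)\<^sup>*\<^sup>* (list_encode xs) c \<and> \<Phi> (list_decode c) = Some (True, y)"
  then obtain c where run: "(query_step \<Phi> g)\<^sup>*\<^sup>* (list_encode xs) c"
    and halt: "\<Phi> (list_decode c) = Some (True, y)"
    by blast
  have "seq_run \<Phi> g (list_decode c) = Some y"
    using halt by (subst seq_run.simps) simp
  with seq_run_query_step_rtranclp[OF run] show "seq_run \<Phi> g xs = Some y" by simp
qed (rule seq_run_eq_SomeD)

lemma Phi_list_decode_eq_Some_iff:
  "Phi e (list_decode c) = Some (b, q) \<longleftrightarrow> eval_prog (prog_of e) c = Some (q + q + of_bool b)"
  unfolding Phi_def by (cases b) (auto elim!: oddE evenE)

lemma ce_in_seq_comp [ce_in_intros]: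
  assumes "computable F" "computable G"
  shows "ce_in h (\<lambda>x. seq_comp (Phi e) (Some \<circ> h) (F x) = Some (G x))"
  unfolding seq_comp_def seq_run_eq_Some_iff query_step_def Phi_list_decode_eq_Some_iff o_apply
    option.inject
  by (intro ce_in_intros computable_intros assms[THEN computable_comp])

section \<open>Constructing oracle computations\<close>

lemma ex_Phi_index:
  assumes "computable (\<lambda>c. B (list_decode c))" "computable (\<lambda>c. Q (list_decode c))"
  shows "\<exists>e. \<forall>xs. Phi e xs = Some (B xs \<noteq> 0, Q xs)"
proof -
  have "computable (\<lambda>c. if B (list_decode c) = 0 then Q (list_decode c) + Q (list_decode c)
      else Suc (Q (list_decode c) + Q (list_decode c)))"
    by (intro computable_intros assms)
  then obtain e where e: "\<And>c. eval_prog (prog_of e) c =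
      Some (if B (list_decode c) = 0 then Q (list_decode c) + Q (list_decode c)
        else Suc (Q (list_decode c) + Q (list_decode c)))"
    unfolding computable_def using surj_prog_of by metis
  have "\<forall>xs. Phi e xs = Some (B xs \<noteq> 0, Q xs)"
    by (simp add: Phi_def e)
  then show ?thesis ..
qed

lemma ex_single_query_index:
  assumes "computable A" "computable (\<lambda>z. B (pfst z) (psnd z))"
  shows "\<exists>e. \<forall>f n. seq_comp (Phi e) f n = map_option (B n) (f (A n))"
proof -
  let ?answer = "\<lambda>xs. if length (tl xs) = 0 then A (hd xs) else B (hd xs) (hd (tl xs))"
  have "\<exists>e. \<forall>xs. Phi e xs = Some (length (tl xs) \<noteq> 0, ?answer xs)"
    by (intro ex_Phi_index computable_intros computable_comp[OF assms(1)] computable_comp2[OF assms(2)])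
  then obtain e where e: "\<And>xs. Phi e xs = Some (length (tl xs) \<noteq> 0, ?answer xs)" by blast
  have "seq_comp (Phi e) f n = map_option (B n) (f (A n))" for f n
    unfolding seq_comp_def
    by (subst seq_run.simps, cases "f (A n)") (simp_all add: e seq_run.simps[of _ _ "[n, _]"])
  then show ?thesis by blast
qed

lemma seq_comp_unbounded_search:
  assumes "\<And>s. \<Phi> (n # map h [0..<s]) \<in> {Some (False, s), Some (True, y)}"
    and "\<Phi> (n # map h [0..<t]) = Some (True, y)"
  shows "seq_comp \<Phi> (Some \<circ> h) n = Some y"
proof -
  have "seq_run \<Phi> (Some \<circ> h) (n # map h [0..<s]) = Some y" if "s \<le> t" for s
    using that
  proof (induction s rule: inc_induct)
    case base
    show ?case using assms(2) by (subst seq_run.simps) simp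
  next
    case (step s)
    then show ?case using assms(1)[of s] by (subst seq_run.simps) (auto simp: comp_def)
  qed
  from this[of 0] show ?thesis by (simp add: seq_comp_def)
qed

lemma subT_le_if_ce_in_graph:
  assumes "ce_in h (\<lambda>z. f (pfst z) = Some (psnd z))"
  shows "f \<le>\<^sub>s\<^sub>u\<^sub>b\<^sub>T (Some \<circ> h)"
proof -
  obtain W where W: "ce_test h (\<lambda>z. f (pfst z) = Some (psnd z)) W"
    using assms unfolding ce_in_def by blast
  let ?search = "\<lambda>xs. witness_search W (hd xs) (tl xs)"
  let ?answer = "\<lambda>xs. if ?search xs = 0 then length (tl xs) else ?search xs - 1"
  have "\<exists>e. \<forall>xs. Phi e xs = Some (?search xs \<noteq> 0, ?answer xs)"
    by (intro ex_Phi_index computable_intros computable_witness_search[OF W])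
  then obtain e where e: "\<And>xs. Phi e xs = Some (?search xs \<noteq> 0, ?answer xs)" by blast
  have "seq_comp (Phi e) (Some \<circ> h) n = Some y" if y: "f n = Some y" for n y
  proof -
    have found: "y' = y" if "witness_search W n (map h [0..<s]) = Suc y'" for s y'
      using witness_search_sound[OF W that] y by simp
    obtain t where t: "witness_search W n (map h [0..<t]) \<noteq> 0"
      using witness_search_eventually[OF W, of n y] y by (auto simp: eventually_at_top_linorder)
    show ?thesis
    proof (rule seq_comp_unbounded_search)
      show "Phi e (n # map h [0..<s]) \<in> {Some (False, s), Some (True, y)}" for s
        using found[of s] by (cases "witness_search W n (map h [0..<s])") (auto simp: e)
      show "Phi e (n # map h [0..<t]) = Some (True, y)"
        using found[of t] t by (cases "witness_search W n (map h [0..<t])") (auto simp: e)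
    qed
  qed
  then have "f \<subseteq>\<^sub>m seq_comp (Phi e) (Some \<circ> h)" by (auto simp: map_le_def)
  then show ?thesis unfolding subT_le_def ..
qed

section \<open>The meet of two total functions\<close>

lemma ex_equality_query_index:
  assumes "computable A" "computable U"
  shows "\<exists>e. \<forall>f n. seq_comp (Phi e) (Some \<circ> f) n = Some (if f (A n) = U n then 0 else 1)"
proof -
  have "computable (\<lambda>z. if psnd z = U (pfst z) then 0 else 1)"
    by (intro computable_intros computable_comp[OF assms(2)])
  from ex_single_query_index[OF assms(1), of "\<lambda>n y. if y = U n then 0 else 1", OF this]
  obtain e where "\<And>f n. seq_comp (Phi e) f n = map_option (\<lambda>y. if y = U n then 0 else 1) (f (A n))"
    by blast
  then show ?thesis by (intro exI[of _ e]) simp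
qed

abbreviation quadruple :: "nat \<Rightarrow> nat \<Rightarrow> nat \<Rightarrow> nat \<Rightarrow> nat" where
  "quadruple a b u v \<equiv> prod_encode (prod_encode (a, b), prod_encode (u, v))"

lemma subT_meet_le_imp_ce_in_cross:
  assumes "(Some \<circ> f) \<sqinter>\<^sub>s\<^sub>u\<^sub>b\<^sub>T (Some \<circ> g) \<le>\<^sub>s\<^sub>u\<^sub>b\<^sub>T (Some \<circ> h)"
  shows "\<exists>S. ce_in h S \<and> (\<forall>a b. S (quadruple a b (f a) (g b))) \<and>
    (\<forall>a b u v. S (quadruple a b u v) \<longrightarrow> u = f a \<or> v = g b)"
proof -
  obtain i where i: "(Some \<circ> f) \<sqinter>\<^sub>s\<^sub>u\<^sub>b\<^sub>T (Some \<circ> g) \<subseteq>\<^sub>m seq_comp (Phi i) (Some \<circ> h)"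
    using assms unfolding subT_le_def by blast
  obtain d where d: "\<And>f n. seq_comp (Phi d) (Some \<circ> f) n =
      Some (if f (pfst (pfst n)) = pfst (psnd n) then 0 else 1)"
    using ex_equality_query_index[of "\<lambda>n. pfst (pfst n)" "\<lambda>n. pfst (psnd n)"]
    by (auto simp: computable_intros)
  obtain e where e: "\<And>f n. seq_comp (Phi e) (Some \<circ> f) n =
      Some (if f (psnd (pfst n)) = psnd (psnd n) then 0 else 1)"
    using ex_equality_query_index[of "\<lambda>n. psnd (pfst n)" "\<lambda>n. psnd (psnd n)"]
    by (auto simp: computable_intros)
  let ?code = "\<lambda>z. prod_encode (d, prod_encode (e, z))"
  have "((Some \<circ> f) \<sqinter>\<^sub>s\<^sub>u\<^sub>b\<^sub>T (Some \<circ> g)) (?code (quadruple a b u v)) =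
      (if (f a = u) = (g b = v) then Some (if f a = u then 0 else 1) else None)" for a b u v
    by (simp add: subT_meet_def d e)
  with i have answer: "seq_comp (Phi i) (Some \<circ> h) (?code (quadruple a b u v)) =
      Some (if f a = u then 0 else 1)" if "(f a = u) = (g b = v)" for a b u v
    using that by (auto simp: map_le_def dom_def)
  let ?S = "\<lambda>z. seq_comp (Phi i) (Some \<circ> h) (?code z) = Some 0"
  have "ce_in h ?S"
    by (intro ce_in_intros computable_intros)
  moreover have "?S (quadruple a b (f a) (g b))" for a b
    using answer[of a "f a" b "g b"] by simp
  moreover have "u = f a \<or> v = g b" if "?S (quadruple a b u v)" for a b u v
    using answer[of a u b v] that by (cases "f a = u"; cases "g b = v") auto
  ultimately show ?thesis by blast
qed

lemma subT_le_if_ce_in_cross: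
  assumes S: "ce_in h S"
    and center: "\<And>a b. S (quadruple a b (f a) (g b))"
    and cross: "\<And>a b u v. S (quadruple a b u v) \<Longrightarrow> u = f a \<or> v = g b"
  shows "(Some \<circ> f) \<le>\<^sub>s\<^sub>u\<^sub>b\<^sub>T (Some \<circ> h) \<or> (Some \<circ> g) \<le>\<^sub>s\<^sub>u\<^sub>b\<^sub>T (Some \<circ> h)"
proof (cases "\<forall>b. \<exists>a v u u'. u \<noteq> u' \<and> S (quadruple a b u v) \<and> S (quadruple a b u' v)")
  case True
  moreover have "v = g b" if "u \<noteq> u'" "S (quadruple a b u v)" "S (quadruple a b u' v)" for a b u u' v
    using that cross by blast
  ultimately have graph_g: "(Some \<circ> g) b = Some v \<longleftrightarrow>
      (\<exists>a u u'. u \<noteq> u' \<and> S (quadruple a b u v) \<and> S (quadruple a b u' v))" for b v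
    by (simp only: o_apply option.inject) blast
  have "(Some \<circ> g) \<le>\<^sub>s\<^sub>u\<^sub>b\<^sub>T (Some \<circ> h)"
    by (rule subT_le_if_ce_in_graph, unfold graph_g)
      (intro ce_in_intros ce_in_comp[OF S] computable_intros)
  then show ?thesis ..
next
  case False
  then obtain b where "u = u'" if "S (quadruple a b u v)" "S (quadruple a b u' v)" for a u u' v
    by blast
  then have "u = f a" if "S (quadruple a b u v)" for a u v
    using that center cross by blast
  then have graph_f: "(Some \<circ> f) a = Some u \<longleftrightarrow> (\<exists>v. S (quadruple a b u v))" for a u
    using center by (simp only: o_apply option.inject) blast
  have "(Some \<circ> f) \<le>\<^sub>s\<^sub>u\<^sub>b\<^sub>T (Some \<circ> h)"
    by (rule subT_le_if_ce_in_graph, unfold graph_f)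
      (intro ce_in_intros ce_in_comp[OF S] computable_intros)
  then show ?thesis ..
qed

theorem theorem4p6:
  fixes f g h :: "nat \<Rightarrow> nat"
  assumes "(Some \<circ> f) \<sqinter>\<^sub>s\<^sub>u\<^sub>b\<^sub>T (Some \<circ> g) \<le>\<^sub>s\<^sub>u\<^sub>b\<^sub>T (Some \<circ> h)"
  shows "(Some \<circ> f) \<le>\<^sub>s\<^sub>u\<^sub>b\<^sub>T (Some \<circ> h) \<or> (Some \<circ> g) \<le>\<^sub>s\<^sub>u\<^sub>b\<^sub>T (Some \<circ> h)"
proof -
  obtain S where "ce_in h S" "\<And>a b. S (quadruple a b (f a) (g b))"
    "\<And>a b u v. S (quadruple a b u v) \<Longrightarrow> u = f a \<or> v = g b"
    using subT_meet_le_imp_ce_in_cross[OF assms] by blast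
  then show ?thesis by (rule subT_le_if_ce_in_cross)
qed

end
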